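(* Let $n\ge1$, let $\vec\epsilon=(\epsilon_1,\dots,\epsilon_n)$ with $0\le\epsilon_i\le\tfrac12$ for all $i$, and let $f:\{0,1\}^n\to\mathbb{R}$ be nonnegative and not identically zero. (i) For every integer $q\ge2$, \[ \ln \|T_{\vec\epsilon} f\|_q ~\le~ \mathbb{E}_{T \sim \vec\lambda}\, \ln \| \mathbb{E}(f|T)\|_q, \qquad \lambda_i = 1 + \frac{1}{q-1}\log_2\!\big(\epsilon_i^q + (1-\epsilon_i)^q\big). \] (ii) Also \[ \ln \|T_{\vec\epsilon} f\|_{\infty} ~\le~ \mathbb{E}_{T \sim \vec\lambda}\, \ln \| \mathbb{E}(f|T)\|_{\infty}, \qquad \lambda_i = 1 + \log_2(1-\epsilon_i). \] (iii) Both inequalities hold with equality whenever $f$ is the characteristic function of a (nonempty) subcube of $\{0,1\}^n$.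
   Context: Norms are with respect to the uniform probability measure on $\{0,1\}^n$: $\|g\|_q=(\mathbb{E}_x |g(x)|^q)^{1/q}$, $\|g\|_\infty=\max_x|g(x)|$. For $\vec\epsilon=(\epsilon_1,\dots,\epsilon_n)\in[0,\tfrac12]^n$, the operator $T_{\vec\epsilon}$ is defined by $(T_{\vec\epsilon}f)(x)=\mathbb{E}f(y)$, where $y$ is random with $y_i=x_i$ with probability $1-\epsilon_i$ and $y_i=1-x_i$ with probability $\epsilon_i$, independently over $i$. For $\vec\lambda=(\lambda_1,\dots,\lambda_n)\in[0,1]^n$, $T\sim\vec\lambda$ denotes a random subset of $[n]$ containing each $i$ independently with probability $\lambda_i$. For $T\subseteq[n]$, $\mathbb{E}(f|T)(x)=\mathbb{E}_{y:\,y|_T=x|_T} f(y)$ (uniform average over $y$ agreeing with $x$ on $T$). A subcube is a set $\{x\in\{0,1\}^n: x_i=a_i \ \forall i\in K\}$ for some $K\subseteq[n]$, $a\in\{0,1\}^K$. *)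

theory Defs
  imports Complex_Main
begin

text \<open>Points of the cube {0,1}^n are represented as functions nat => bool that
  vanish (are False) outside {0..<n}; x i = True means x_i = 1.\<close>

definition cube :: "nat \<Rightarrow> (nat \<Rightarrow> bool) set" where
  "cube n = {x. \<forall>i\<ge>n. \<not> x i}"

definition cexp :: "nat \<Rightarrow> ((nat \<Rightarrow> bool) \<Rightarrow> real) \<Rightarrow> real" where
  "cexp n g = (\<Sum>x\<in>cube n. g x) / 2 ^ n"

definition qnorm :: "nat \<Rightarrow> nat \<Rightarrow> ((nat \<Rightarrow> bool) \<Rightarrow> real) \<Rightarrow> real" where
  "qnorm n q g = (cexp n (\<lambda>x. \<bar>g x\<bar> ^ q)) powr (1 / real q)"

definition infnorm :: "nat \<Rightarrow> ((nat \<Rightarrow> bool) \<Rightarrow> real) \<Rightarrow> real" where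
  "infnorm n g = Max ((\<lambda>x. \<bar>g x\<bar>) ` cube n)"

definition noise :: "nat \<Rightarrow> (nat \<Rightarrow> real) \<Rightarrow> ((nat \<Rightarrow> bool) \<Rightarrow> real) \<Rightarrow> (nat \<Rightarrow> bool) \<Rightarrow> real" where
  "noise n eps f x = (\<Sum>y\<in>cube n. (\<Prod>i<n. if y i = x i then 1 - eps i else eps i) * f y)"

definition condE :: "nat \<Rightarrow> nat set \<Rightarrow> ((nat \<Rightarrow> bool) \<Rightarrow> real) \<Rightarrow> (nat \<Rightarrow> bool) \<Rightarrow> real" where
  "condE n T f x = (\<Sum>y\<in>{y\<in>cube n. \<forall>i\<in>T. y i = x i}. f y) / real (card {y\<in>cube n. \<forall>i\<in>T. y i = x i})"

definition rsexp :: "nat \<Rightarrow> (nat \<Rightarrow> real) \<Rightarrow> (nat set \<Rightarrow> real) \<Rightarrow> real" where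
  "rsexp n lam F = (\<Sum>T\<in>Pow {..<n}. (\<Prod>i<n. if i \<in> T then lam i else 1 - lam i) * F T)"

definition subcube :: "nat \<Rightarrow> nat set \<Rightarrow> (nat \<Rightarrow> bool) \<Rightarrow> (nat \<Rightarrow> bool) set" where
  "subcube n K a = {x\<in>cube n. \<forall>i\<in>K. x i = a i}"

definition charfun :: "(nat \<Rightarrow> bool) set \<Rightarrow> (nat \<Rightarrow> bool) \<Rightarrow> real" where
  "charfun S x = (if x \<in> S then 1 else 0)"

definition lam_q :: "nat \<Rightarrow> (nat \<Rightarrow> real) \<Rightarrow> nat \<Rightarrow> real" where
  "lam_q q eps i = 1 + (1 / (real q - 1)) * log 2 (eps i ^ q + (1 - eps i) ^ q)"

definition lam_inf :: "(nat \<Rightarrow> real) \<Rightarrow> nat \<Rightarrow> real" where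
  "lam_inf eps i = 1 + log 2 (1 - eps i)"

end

theory Submission
  imports "HOL-Analysis.Convex" Defs
begin

text \<open>
  Conditioning on \<open>T\<close> is the noise operator with rates \<open>0\<close> on \<open>T\<close> and \<open>1/2\<close> off \<open>T\<close>, so the
  bound follows by replacing one rate \<open>\<epsilon>\<^sub>i\<close> at a time by \<open>0\<close> (with weight \<open>\<lambda>\<^sub>i\<close>) or \<open>1/2\<close>
  (with weight \<open>1 - \<lambda>\<^sub>i\<close>). Hoelder's inequality reduces a single replacement to functions on two
  points, normalised to \<open>1 + t\<close> and \<open>1 - t\<close>: with \<open>\<rho> = 1 - 2 \<epsilon>\<close> and
  \<open>G t = ln (((1 + t) ^ q + (1 - t) ^ q) / 2)\<close> it says \<open>G (\<rho> t) \<le> \<lambda> G t\<close>, where \<open>\<lambda>\<close> is such that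
  equality holds at \<open>t = 1\<close>. Equality also holds at \<open>t = 0\<close>, and \<open>\<lambda> G t - G (\<rho> t)\<close> first
  increases and then decreases, because \<open>ln (t G' t)\<close> is a concave function of \<open>ln t\<close>.
  For a subcube, every single replacement is an equality: in direction \<open>i\<close> the function is either
  constant or vanishes at one of any two neighbouring points.
\<close>

section \<open>The two-point inequalities\<close>

text \<open>The derivative has the sign of \<open>c - Q\<close>, which can only pass from positive
  to negative. A negative value \<open>F t\<close> would force, by the mean value theorem on
  \<open>[0, t]\<close> and \<open>[t, 1]\<close>, a negative slope followed by a positive
  one.\<close>

lemma nonneg_of_single_crossing:
  fixes F P Q :: "real \<Rightarrow> real"
  assumes "F 0 = 0" "F 1 = 0" "continuous_on {0..1} F"
    and D: "\<And>t. 0 < t \<Longrightarrow> t < 1 \<Longrightarrow> (F has_real_derivative P t * (c - Q t)) (at t)"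
    and P: "\<And>t. 0 < t \<Longrightarrow> t < 1 \<Longrightarrow> 0 < P t"
    and Q: "\<And>s t. 0 < s \<Longrightarrow> s \<le> t \<Longrightarrow> t < 1 \<Longrightarrow> Q s \<le> Q t"
    and t: "0 \<le> t" "t \<le> 1"
  shows "0 \<le> F t"
proof (rule ccontr)
  assume "\<not> 0 \<le> F t"
  then have neg: "F t < 0" by simp
  with assms t have t': "0 < t" "t < 1"
    by (metis less_eq_real_def less_irrefl)+
  have diff: "F differentiable (at s)" if "0 < s" "s < 1" for s
    using D[OF that] real_differentiable_def by blast
  have "\<exists>l z. 0 < z \<and> z < t \<and> DERIV F z :> l \<and> F t - F 0 = (t - 0) * l"
    using t' assms(3) diff by (intro MVT) (auto intro: continuous_on_subset)
  then obtain l z where z: "0 < z" "z < t" "DERIV F z :> l" "F t = t * l"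
    using assms(1) by auto
  have "\<exists>l z. t < z \<and> z < 1 \<and> DERIV F z :> l \<and> F 1 - F t = (1 - t) * l"
    using t' assms(3) diff by (intro MVT) (auto intro: continuous_on_subset)
  then obtain l' z' where z': "t < z'" "z' < 1" "DERIV F z' :> l'" "- F t = (1 - t) * l'"
    using assms(2) by auto
  have "l = P z * (c - Q z)" "l' = P z' * (c - Q z')"
    using z z' t' D DERIV_unique by (meson order_less_trans)+
  moreover have "l < 0" using z(4) neg t' by (simp add: mult_less_0_iff)
  moreover have "0 < l'" using z'(4) neg t' by (smt (verit) mult_le_0_iff)
  ultimately have "c < Q z" "Q z' < c"
    using P[of z] P[of z'] z z' t' by (simp_all add: mult_less_0_iff zero_less_mult_iff)
  with Q[of z z'] z z' show False by linarith
qed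

section \<open>Twice the even and odd parts of \<open>(1 + t) ^ m\<close>\<close>

definition epow :: "nat \<Rightarrow> real \<Rightarrow> real" where
  "epow m t = (1 + t) ^ m + (1 - t) ^ m"

definition opow :: "nat \<Rightarrow> real \<Rightarrow> real" where
  "opow m t = (1 + t) ^ m - (1 - t) ^ m"

lemma epow_Suc: "epow (Suc m) t = epow m t + t * opow m t"
  and opow_Suc: "opow (Suc m) t = opow m t + t * epow m t"
  by (simp_all add: epow_def opow_def algebra_simps)

text \<open>As polynomials in \<open>t\<close>, \<open>epow m\<close>, \<open>opow m\<close> and
  \<open>opow m t / t\<close> have nonnegative coefficients. The two recursions feed on each other,
  so one induction has to carry all five facts.\<close>

lemma epow_opow_mono:
  assumes "0 < s" "s \<le> t"
  shows "2 \<le> epow m s" "0 \<le> opow m s" "epow m s \<le> epow m t" "opow m s \<le> opow m t"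
    "opow m s / s \<le> opow m t / t"
proof -
  have "2 \<le> epow m s \<and> 0 \<le> opow m s \<and> epow m s \<le> epow m t \<and> opow m s \<le> opow m t
    \<and> opow m s / s \<le> opow m t / t"
  proof (induction m)
    case 0
    then show ?case by (simp add: epow_def opow_def)
  next
    case (Suc m)
    have "s * opow m s \<le> t * opow m t" "s * epow m s \<le> t * epow m t"
      using Suc assms by (auto intro!: mult_mono)
    moreover have "0 \<le> s * opow m s" "0 \<le> s * epow m s" using Suc assms by auto
    ultimately show ?case
      using Suc assms by (auto simp: epow_Suc opow_Suc add_divide_distrib intro: add_increasing2)
  qed
  then show "2 \<le> epow m s" "0 \<le> opow m s" "epow m s \<le> epow m t" "opow m s \<le> opow m t"
    "opow m s / s \<le> opow m t / t" by auto
qed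

lemma epow_pos: "0 \<le> t \<Longrightarrow> 0 < epow m t"
  using epow_opow_mono(1)[of t t m] by (cases "t = 0") (auto simp: epow_def)

lemma opow_pos: "0 < t \<Longrightarrow> 0 < opow (Suc m) t"
  using epow_opow_mono[of t t m] by (simp add: opow_Suc add_nonneg_pos)

lemma DERIV_epow: "(epow m has_real_derivative real m * opow (m - 1) t) (at t)"
  unfolding epow_def opow_def
  by (auto intro!: derivative_eq_intros simp: algebra_simps)

lemma DERIV_opow: "(opow m has_real_derivative real m * epow (m - 1) t) (at t)"
  unfolding epow_def opow_def
  by (auto intro!: derivative_eq_intros simp: algebra_simps)

text \<open>With \<open>u = 1 + t\<close> and \<open>v = 1 - t\<close> the pure powers cancel and
  \<open>(u v) ^ m (u + v)^2\<close> remains, where \<open>u + v = 2\<close>. This eliminates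
  \<open>epow m\<close> from the logarithmic derivative below.\<close>

lemma epow_opow_identity:
  "epow m t * epow (m + 2) t - opow (m + 1) t ^ 2 = 4 * (1 - t\<^sup>2) ^ m"
proof -
  have "epow m t * epow (m + 2) t - opow (m + 1) t ^ 2
      = ((1 + t) ^ m * (1 - t) ^ m) * ((1 + t) + (1 - t))\<^sup>2"
    unfolding epow_def opow_def by (simp add: algebra_simps power2_eq_square power_add)
  also have "(1 + t) ^ m * (1 - t) ^ m = (1 - t\<^sup>2) ^ m"
    by (simp flip: power_mult_distrib add: algebra_simps power2_eq_square)
  finally show ?thesis by (simp add: power2_eq_square)
qed

text \<open>The substitution \<open>w = (1 - t) / (1 + t)\<close> turns the quotient into
  \<open>(1 - w) (1 - w ^ m) / (2 (1 + w ^ (m + 1)))\<close>.\<close>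
lemma opow_epow_quotient_mono:
  assumes "0 < s" "s \<le> t" "t < 1"
  shows "s * opow m s / epow (Suc m) s \<le> t * opow m t / epow (Suc m) t"
proof -
  define w where "w = (\<lambda>t::real. (1 - t) / (1 + t))"
  have eq: "u * opow m u / epow (Suc m) u
      = ((1 - w u) * (1 - w u ^ m)) / (2 * (1 + w u ^ Suc m))" if "0 < u" for u
  proof -
    have a: "1 - u = w u * (1 + u)" and b: "u = (1 - w u) * (1 + u) / 2"
      using that by (simp_all add: w_def field_simps)
    define v where "v = 1 + u"
    define z where "z = w u"
    have v: "v > 0" using that by (simp add: v_def)
    have "u * opow m u / epow (Suc m) u
       = ((1 - z) * v / 2) * (v ^ m - (z * v) ^ m) / (v ^ Suc m + (z * v) ^ Suc m)"
      unfolding opow_def epow_def a[folded v_def z_def] v_def[symmetric]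
      by (subst (1) b[folded v_def z_def]) simp
    also have "\<dots> = ((1 - z) * v * (v ^ m - (z * v) ^ m)) / (2 * (v ^ Suc m + (z * v) ^ Suc m))"
      by simp
    also have "\<dots> = (v ^ Suc m * ((1 - z) * (1 - z ^ m))) / (v ^ Suc m * (2 * (1 + z ^ Suc m)))"
      by (simp add: power_mult_distrib algebra_simps)
    also have "\<dots> = ((1 - z) * (1 - z ^ m)) / (2 * (1 + z ^ Suc m))"
      using v by (subst mult_divide_mult_cancel_left) auto
    finally show ?thesis by (simp add: z_def)
  qed
  have w: "0 \<le> w t" "w t \<le> w s" "w s \<le> 1"
    using assms by (auto simp: w_def field_simps)
  \<comment> \<open>Since \<open>w\<close> decreases in \<open>t\<close>, the numerator grows with
    \<open>t\<close> and the denominator shrinks.\<close>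
  have "((1 - w s) * (1 - w s ^ m)) / (2 * (1 + w s ^ Suc m))
      \<le> ((1 - w t) * (1 - w t ^ m)) / (2 * (1 + w t ^ Suc m))"
  proof (rule frac_le)
    show "(1 - w s) * (1 - w s ^ m) \<le> (1 - w t) * (1 - w t ^ m)"
      using w by (intro mult_mono diff_mono power_mono) (auto simp: power_le_one)
    show "2 * (1 + w t ^ Suc m) \<le> 2 * (1 + w s ^ Suc m)"
      using w by (intro mult_left_mono add_left_mono power_mono) auto
    show "0 < 2 * (1 + w t ^ Suc m)"
      using w by (intro mult_pos_pos add_pos_nonneg zero_le_power) auto
    show "0 \<le> (1 - w t) * (1 - w t ^ m)"
      using w by (auto intro!: mult_nonneg_nonneg power_le_one)
  qed
  with assms eq show ?thesis by simp
qed

text \<open>The logarithmic derivative of \<open>t * opow (q - 1) t / epow q t\<close> with respect to \<open>ln t\<close>,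
  where \<open>q = m + 2\<close>, rewritten by the identity above so that it visibly decreases.\<close>
definition ldq :: "nat \<Rightarrow> real \<Rightarrow> real" where
  "ldq m t = 1 - t * opow (m + 1) t / epow (m + 2) t
     + real (m + 1) * (4 * (1 - t\<^sup>2) ^ m) / ((opow (m + 1) t / t) * epow (m + 2) t)"

lemma ldq_antimono:
  assumes "0 < s" "s \<le> t" "t < 1"
  shows "ldq m t \<le> ldq m s"
proof -
  have t: "0 < t" using assms by simp
  have 1: "s * opow (m + 1) s / epow (m + 2) s \<le> t * opow (m + 1) t / epow (m + 2) t"
    using opow_epow_quotient_mono[OF assms, of "m + 1"] by simp
  have sq: "s\<^sup>2 \<le> t\<^sup>2" "t\<^sup>2 \<le> 1"
    using assms by (auto intro: power_mono simp: power_le_one)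
  \<comment> \<open>Keeping \<open>opow (m + 1) t / t\<close> together makes the denominator a
    product of two increasing factors, while the numerator decreases.\<close>
  have 2: "real (m + 1) * (4 * (1 - t\<^sup>2) ^ m) / ((opow (m + 1) t / t) * epow (m + 2) t)
     \<le> real (m + 1) * (4 * (1 - s\<^sup>2) ^ m) / ((opow (m + 1) s / s) * epow (m + 2) s)"
  proof (rule frac_le)
    show "real (m + 1) * (4 * (1 - t\<^sup>2) ^ m) \<le> real (m + 1) * (4 * (1 - s\<^sup>2) ^ m)"
      using sq by (intro mult_left_mono power_mono) auto
    show "0 \<le> real (m + 1) * (4 * (1 - s\<^sup>2) ^ m)" using sq by simp
    show "0 < opow (m + 1) s / s * epow (m + 2) s"
      using opow_pos[of s m] epow_opow_mono(1)[of s s "m + 2"] assms by simp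
    show "opow (m + 1) s / s * epow (m + 2) s \<le> opow (m + 1) t / t * epow (m + 2) t"
      using epow_opow_mono[OF assms(1,2), of "m + 1"] epow_opow_mono[OF assms(1,2), of "m + 2"]
        epow_opow_mono[of t t "m + 1"] epow_opow_mono[of t t "m + 2"] t assms
      by (intro mult_mono) auto
  qed
  from 1 2 show ?thesis unfolding ldq_def by linarith
qed

text \<open>With \<open>a\<close>, \<open>b\<close>, \<open>c\<close> as in the proof,
  \<open>t\<close> times the derivative is \<open>1 + (m + 1) t c / a - (m + 2) t a / b\<close>.
  Substituting \<open>b c = a^2 + 4 (1 - t^2) ^ m\<close> cancels all but one of the
  \<open>t a / b\<close> terms.\<close>

lemma DERIV_ln_quotient:
  assumes "0 < t"
  shows "((\<lambda>t. ln (t * opow (m + 1) t / epow (m + 2) t)) has_real_derivative ldq m t / t) (at t)"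
proof -
  define a b c where "a = opow (m + 1) t" and "b = epow (m + 2) t" and "c = epow m t"
  have pos: "0 < a" "0 < b"
    using opow_pos[of t m] epow_opow_mono(1)[of t t "m + 2"] assms by (auto simp: a_def b_def)
  have da: "(opow (m + 1) has_real_derivative (m + 1) * c) (at t)"
    using DERIV_opow[of "m + 1" t] by (simp add: c_def)
  have db: "(epow (m + 2) has_real_derivative (m + 2) * a) (at t)"
    using DERIV_epow[of "m + 2" t] by (simp add: a_def)
  have id: "4 * (1 - t\<^sup>2) ^ m = b * c - a\<^sup>2"
    using epow_opow_identity[of m t] by (simp add: a_def b_def c_def mult.commute)
  have "((\<lambda>t. t * opow (m + 1) t) has_real_derivative 1 * a + (m + 1) * c * t) (at t)"
    unfolding a_def using da by (rule DERIV_mult[OF DERIV_ident])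
  from DERIV_divide[OF this db, folded a_def b_def] pos
  have "((\<lambda>t. t * opow (m + 1) t / epow (m + 2) t) has_real_derivative
      ((a + t * ((m + 1) * c)) * b - t * a * ((m + 2) * a)) / (b * b)) (at t)"
    by (simp add: mult_ac)
  from DERIV_chain2[OF DERIV_ln_divide this, folded a_def b_def] pos assms
  have "((\<lambda>t. ln (t * opow (m + 1) t / epow (m + 2) t)) has_real_derivative
      (1 / (t * a / b)) * (((a + t * ((m + 1) * c)) * b - t * a * ((m + 2) * a)) / (b * b))) (at t)"
    by simp
  moreover have "(1 / (t * a / b)) * (((a + t * ((m + 1) * c)) * b - t * a * ((m + 2) * a)) / (b * b))
     = ldq m t / t"
    unfolding ldq_def id a_def[symmetric] b_def[symmetric] using pos assms
    by (simp add: divide_simps) (simp add: algebra_simps power2_eq_square)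
  ultimately show ?thesis by simp
qed

text \<open>Up to the factor \<open>m + 2\<close>, \<open>D t\<close> is \<open>t\<close> times the
  derivative of \<open>G\<close>. Hence the derivative of \<open>F\<close> is a positive factor
  times \<open>c - D (r * t) / D t\<close>, and single crossing applies once that ratio is seen to
  be nondecreasing.\<close>

lemma two_point_core:
  assumes r: "0 < r" "r < 1" and t: "0 \<le> t" "t \<le> 1"
  shows "ln (epow (m + 2) (r * t) / 2)
     \<le> ln (epow (m + 2) r / 2) / ln (epow (m + 2) 1 / 2) * ln (epow (m + 2) t / 2)"
proof -
  define G where "G = (\<lambda>t. ln (epow (m + 2) t / 2))"
  \<comment> \<open>The value that makes \<open>F\<close> vanish at \<open>1\<close>.\<close>
  define c where "c = G r / G 1"
  define D where "D = (\<lambda>t. t * opow (m + 1) t / epow (m + 2) t)"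
  define F where "F = (\<lambda>t. c * G t - G (r * t))"
  have DG: "(G has_real_derivative (m + 2) * opow (m + 1) u / epow (m + 2) u) (at u)" if "0 \<le> u" for u
    unfolding G_def using epow_pos[OF that, of "m + 2"]
    by (auto intro!: derivative_eq_intros DERIV_epow)
  have Dpos: "0 < D u" if "0 < u" for u
    using that opow_pos[of u m] epow_pos[of u] by (auto simp: D_def)
  have DF: "(F has_real_derivative c * ((m + 2) * opow (m + 1) u / epow (m + 2) u)
      - (m + 2) * opow (m + 1) (r * u) / epow (m + 2) (r * u) * r) (at u)" if "0 \<le> u" for u
    unfolding F_def using that r
    by (auto intro!: derivative_eq_intros DG DERIV_chain2[OF DG])
  have G1: "G 1 > 0" unfolding G_def epow_def using one_less_power[of "2::real" "Suc m"] by simp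
  have "0 \<le> F t"
  proof (rule nonneg_of_single_crossing[where F = F and c = c and P = "\<lambda>t. (m + 2) * D t / t"
      and Q = "\<lambda>t. D (r * t) / D t"])
    show "F 0 = 0" by (simp add: F_def G_def epow_def)
    show "F 1 = 0" using G1 by (simp add: F_def c_def)
    show "continuous_on {0..1} F"
      using DF by (intro DERIV_continuous_on) (auto intro: DERIV_subset)
    show "(F has_real_derivative (m + 2) * D u / u * (c - D (r * u) / D u)) (at u)"
      if "0 < u" "u < 1" for u
    proof (rule DERIV_cong[OF DF])
      have "(m + 2) * D u / u * (c - D (r * u) / D u) = c * ((m + 2) * D u / u) - (m + 2) * D (r * u) / u"
        using Dpos[OF that(1)] that by (simp add: field_simps)
      also have "\<dots> = c * ((m + 2) * opow (m + 1) u / epow (m + 2) u)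
        - (m + 2) * opow (m + 1) (r * u) / epow (m + 2) (r * u) * r"
        using that by (simp add: D_def)
      finally show "c * ((m + 2) * opow (m + 1) u / epow (m + 2) u)
        - (m + 2) * opow (m + 1) (r * u) / epow (m + 2) (r * u) * r
        = (m + 2) * D u / u * (c - D (r * u) / D u)" by simp
    qed (use that in simp)
    show "0 < (m + 2) * D u / u" if "0 < u" "u < 1" for u
      using Dpos[OF that(1)] that by simp
    show "D (r * s) / D s \<le> D (r * u) / D u" if "0 < s" "s \<le> u" "u < 1" for s u
    proof -
      have lnD: "((\<lambda>v. ln (D v)) has_real_derivative ldq m v / v) (at v)" if "0 < v" for v
        using DERIV_ln_quotient[OF that, of m] by (simp add: D_def)
      \<comment> \<open>This is concavity of \<open>ln D\<close> in the variable
        \<open>ln t\<close>: the derivative of the difference is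
        \<open>(ldq m (r * v) - ldq m v) / v\<close>, and \<open>ldq\<close> decreases while
        \<open>r * v \<le> v\<close>.\<close>
      have "ln (D (r * s)) - ln (D s) \<le> ln (D (r * u)) - ln (D u)"
      proof (rule DERIV_nonneg_imp_nondecreasing[OF that(2)])
        fix v assume v: "s \<le> v" "v \<le> u"
        then have v0: "0 < v" "v < 1" using that by auto
        have "((\<lambda>v. ln (D (r * v)) - ln (D v)) has_real_derivative
            ldq m (r * v) / (r * v) * r - ldq m v / v) (at v)"
          using v0 r by (intro DERIV_diff DERIV_chain2[OF lnD] lnD) (auto intro!: derivative_eq_intros)
        moreover have "ldq m v \<le> ldq m (r * v)"
          using v0 r by (intro ldq_antimono) (auto simp: mult_le_cancel_right1)
        then have "0 \<le> ldq m (r * v) / (r * v) * r - ldq m v / v"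
          using v0 r by (simp add: divide_right_mono)
        ultimately show "\<exists>y. ((\<lambda>v. ln (D (r * v)) - ln (D v)) has_real_derivative y) (at v) \<and> 0 \<le> y"
          by blast
      qed
      then have "ln (D (r * s) / D s) \<le> ln (D (r * u) / D u)"
        using Dpos[of s] Dpos[of u] Dpos[of "r * s"] Dpos[of "r * u"] that r by (simp add: ln_div)
      then show ?thesis
        using Dpos[of s] Dpos[of u] Dpos[of "r * s"] Dpos[of "r * u"] that r by simp
    qed
  qed (use t in auto)
  then show ?thesis by (simp add: F_def G_def c_def)
qed

section \<open>The exponent \<open>lam_q\<close> and the two-point bound for \<open>q\<close>-th
  moments\<close>

lemma le_powr_if_ln_le:
  fixes x y l :: real
  assumes "ln x \<le> l * ln y" "0 < x" "0 < y"
  shows "x \<le> y powr l"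
proof -
  have "ln x \<le> ln (y powr l)" using assms by (simp add: ln_powr)
  then show ?thesis using assms by (subst (asm) ln_le_cancel_iff) auto
qed

text \<open>For \<open>r = 1 - 2 * eps i\<close> one has \<open>1 + r = 2 (1 - eps i)\<close> and
  \<open>1 - r = 2 eps i\<close>, so \<open>epow q r / 2\<close> is \<open>2 ^ (q - 1)\<close> times
  the argument of the logarithm in \<open>lam_q\<close>. The exponent is thus the one that gives
  equality at \<open>t = 1\<close>.\<close>

lemma lam_q_eq:
  assumes "0 \<le> eps i" "eps i \<le> 1 / 2" "2 \<le> q"
  shows "lam_q q eps i = ln (epow q (1 - 2 * eps i) / 2) / ln (epow q 1 / 2)"
proof -
  define p where "p = eps i ^ q + (1 - eps i) ^ q"
  have p: "p > 0" using assms by (auto simp: p_def intro: add_nonneg_pos)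
  have q: "(2::real) ^ q = 2 * 2 ^ (q - 1)"
    using assms by (cases q) auto
  have "epow q (1 - 2 * eps i) = (2 * (1 - eps i)) ^ q + (2 * eps i) ^ q"
    by (simp add: epow_def algebra_simps)
  also have "\<dots> = 2 ^ q * p"
    unfolding p_def power_mult_distrib by (simp add: algebra_simps)
  finally have "epow q (1 - 2 * eps i) / 2 = 2 ^ (q - 1) * p"
    using q by simp
  moreover have "epow q 1 / 2 = 2 ^ (q - 1)"
    using assms q by (simp add: epow_def)
  ultimately have "ln (epow q (1 - 2 * eps i) / 2) = (real q - 1) * ln 2 + ln p"
    "ln (epow q 1 / 2) = (real q - 1) * ln 2"
    using p assms by (simp_all add: ln_mult ln_realpow of_nat_diff)
  then show ?thesis
    using assms by (simp add: lam_q_def log_def p_def[symmetric] add_divide_distrib)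
qed

text \<open>Since \<open>1 \<le> epow q r / 2 \<le> epow q 1 / 2\<close>, the quotient of logarithms
  lies in \<open>[0, 1]\<close>. It can then serve both as a probability and as a Hoelder
  exponent.\<close>

lemma lam_q_bounds:
  assumes "0 \<le> eps i" "eps i \<le> 1 / 2" "2 \<le> q"
  shows "0 \<le> lam_q q eps i" "lam_q q eps i \<le> 1"
proof -
  define r where "r = 1 - 2 * eps i"
  have r: "0 \<le> r" "r \<le> 1" using assms by (auto simp: r_def)
  have 1: "1 \<le> epow q r / 2"
    using epow_opow_mono(1)[of r r q] r by (cases "r = 0") (auto simp: epow_def)
  have 2: "epow q r \<le> epow q 1"
  proof (cases "r = 0")
    case True
    then show ?thesis using epow_opow_mono(1)[of 1 1 q] by (simp add: epow_def)
  next
    case False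
    then show ?thesis using epow_opow_mono(3)[of r 1 q] r by simp
  qed
  show "0 \<le> lam_q q eps i" "lam_q q eps i \<le> 1"
    unfolding lam_q_eq[of eps i, OF assms] r_def[symmetric] using 1 2
    by (auto simp: divide_le_eq_1)
qed

lemma two_point_normalized:
  assumes "0 \<le> eps i" "eps i \<le> 1 / 2" "2 \<le> q" and t: "0 \<le> t" "t \<le> 1"
  shows "epow q ((1 - 2 * eps i) * t) / 2 \<le> (epow q t / 2) powr lam_q q eps i"
proof -
  define r where "r = 1 - 2 * eps i"
  have r: "0 \<le> r" "r \<le> 1" using assms by (auto simp: r_def)
  have lam: "lam_q q eps i = ln (epow q r / 2) / ln (epow q 1 / 2)"
    using lam_q_eq[of eps i, OF assms(1-3)] by (simp add: r_def)
  have pos: "0 < epow q (r * t)" "0 < epow q t" using r t by (auto intro: epow_pos)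
  have "(1::real) < 2 ^ (q - 1)" using assms by (intro one_less_power) auto
  then have "1 < epow q 1 / 2" using assms by (cases q) (auto simp: epow_def)
  then have one: "0 < ln (epow q 1 / 2)" by simp
  have "ln (epow q (r * t) / 2) \<le> lam_q q eps i * ln (epow q t / 2)"
  proof -
    \<comment> \<open>At the two ends \<open>lam_q\<close> is \<open>0\<close> and \<open>1\<close>
      respectively, and both sides coincide.\<close>
    consider "r = 0" | "r = 1" | "0 < r" "r < 1" using r by linarith
    then show ?thesis
    proof cases
      case 1
      then show ?thesis using lam by (simp add: epow_def)
    next
      case 2
      then show ?thesis using lam one by simp
    next
      case 3
      then show ?thesis
        using two_point_core[OF 3 t, of "q - 2"] assms(3) lam by (simp del: add_2_eq_Suc')
    qed
  qed
  then show ?thesis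
    using pos unfolding r_def[symmetric] by (intro le_powr_if_ln_le) auto
qed

text \<open>Both sides are homogeneous of degree \<open>q\<close> and symmetric in \<open>a\<close>
  and \<open>b\<close>. Dividing by the mean turns the pair into \<open>1 + t\<close> and
  \<open>1 - t\<close>, and noise keeps the mean and multiplies \<open>t\<close> by
  \<open>r\<close>.\<close>

lemma two_point:
  assumes "0 \<le> eps i" "eps i \<le> 1 / 2" "2 \<le> q" "0 \<le> a" "0 \<le> b"
  shows "(((1 - eps i) * a + eps i * b) ^ q + ((1 - eps i) * b + eps i * a) ^ q) / 2
    \<le> ((a ^ q + b ^ q) / 2) powr lam_q q eps i * (((a + b) / 2) ^ q) powr (1 - lam_q q eps i)"
  using assms(4,5)
proof (induction a b rule: linorder_wlog)
  case (sym a b)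
  then show ?case by (simp add: add.commute)
next
  case (le b a)
  define m where "m = (a + b) / 2"
  define l where "l = lam_q q eps i"
  define r where "r = 1 - 2 * eps i"
  show ?case
  proof (cases "m = 0")
    case True
    with le have "a = 0" "b = 0" by (auto simp: m_def)
    then show ?thesis using assms by (simp add: power_0_left)
  next
    case False
    with le have m: "m > 0" by (simp add: m_def)
    define t where "t = (a - b) / (a + b)"
    have t: "0 \<le> t" "t \<le> 1" using m le by (auto simp: t_def m_def)
    have a: "a = m * (1 + t)" and b: "b = m * (1 - t)"
      using m by (simp_all add: t_def m_def field_simps)
    have "(((1 - eps i) * a + eps i * b) ^ q + ((1 - eps i) * b + eps i * a) ^ q) / 2
        = ((m * (1 + r * t)) ^ q + (m * (1 - r * t)) ^ q) / 2"
      unfolding a b r_def by (simp add: algebra_simps)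
    also have "\<dots> = m ^ q * (epow q (r * t) / 2)"
      unfolding epow_def power_mult_distrib by (simp add: algebra_simps)
    also have "\<dots> \<le> m ^ q * ((epow q t / 2) powr l)"
      using two_point_normalized[of eps i, OF assms(1-3) t] m by (simp add: r_def l_def)
    also have "\<dots> = (m ^ q * (epow q t / 2)) powr l * (m ^ q) powr (1 - l)"
    proof -
      have "(m ^ q) powr l * (m ^ q) powr (1 - l) = m ^ q"
        using m by (simp flip: powr_add)
      moreover have "(m ^ q * (epow q t / 2)) powr l = (m ^ q) powr l * (epow q t / 2) powr l"
        by (rule powr_mult)
      ultimately show ?thesis by (metis mult.assoc mult.commute)
    qed
    also have "m ^ q * (epow q t / 2) = (a ^ q + b ^ q) / 2"
      unfolding a b epow_def power_mult_distrib by (simp add: algebra_simps)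
    finally show ?thesis by (simp add: m_def l_def add_ac)
  qed
qed

section \<open>The two-point bound for the maximum norm\<close>

lemma lam_inf_bounds:
  assumes "0 \<le> eps i" "eps i \<le> 1 / 2"
  shows "0 \<le> lam_inf eps i" "lam_inf eps i \<le> 1"
proof -
  have "log 2 (1/2) \<le> log 2 (1 - eps i)" "log 2 (1 - eps i) \<le> log 2 1"
    using assms by (subst log_le_cancel_iff; simp)+
  moreover have "log 2 (1/2::real) = -1" by (simp add: log_divide)
  ultimately show "0 \<le> lam_inf eps i" "lam_inf eps i \<le> 1"
    by (simp_all add: lam_inf_def)
qed

text \<open>After the same normalisation, with the larger value first, the claim is
  \<open>1 + r * t \<le> (1 + t) powr l\<close>. It is tight at \<open>t = 0\<close> and
  \<open>t = 1\<close>, and again follows by single crossing.\<close>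

lemma two_point_inf:
  assumes e: "0 \<le> eps i" "eps i \<le> 1 / 2" and "0 \<le> a" "0 \<le> b"
  shows "(1 - eps i) * a + eps i * b
    \<le> max a b powr lam_inf eps i * ((a + b) / 2) powr (1 - lam_inf eps i)"
proof -
  define l where "l = lam_inf eps i"
  define r where "r = 1 - 2 * eps i"
  have r: "0 \<le> r" "r \<le> 1" using assms by (auto simp: r_def)
  \<comment> \<open>That is, \<open>2 powr l = 1 + r\<close>, the equality at
    \<open>t = 1\<close>.\<close>
  have "l * ln 2 = ln 2 + ln (1 - eps i)"
    by (simp add: l_def lam_inf_def log_def field_simps)
  also have "\<dots> = ln (1 + r)"
    using e ln_mult[of 2 "1 - eps i"] by (simp add: r_def algebra_simps)
  finally have l: "l * ln 2 = ln (1 + r)" .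
  have main: "(1 - eps i) * x + eps i * y \<le> x powr l * ((x + y) / 2) powr (1 - l)"
    if xy: "0 \<le> y" "y \<le> x" for x y
  proof (cases "x = 0")
    case True
    then show ?thesis using xy by simp
  next
    case False
    define m where "m = (x + y) / 2"
    have m: "m > 0" using False xy by (simp add: m_def)
    define t where "t = (x - y) / (x + y)"
    have t: "0 \<le> t" "t \<le> 1" using m xy by (auto simp: t_def m_def)
    have a: "x = m * (1 + t)" and b: "y = m * (1 - t)"
      using m by (simp_all add: t_def m_def field_simps)
    have "0 \<le> l * ln (1 + t) - ln (1 + r * t)"
    proof (rule nonneg_of_single_crossing[where t = t
          and F = "\<lambda>t. l * ln (1 + t) - ln (1 + r * t)" and P = "\<lambda>t. 1 / (1 + t)" and c = l
          and Q = "\<lambda>t. r * (1 + t) / (1 + r * t)"])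
      have D: "((\<lambda>t. l * ln (1 + t) - ln (1 + r * t)) has_real_derivative
         l / (1 + u) - r / (1 + r * u)) (at u)" if "0 \<le> u" for u
        using that r add_pos_nonneg[of 1 "r * u"]
        by (auto intro!: derivative_eq_intros simp: divide_simps)
      show "continuous_on {0..1} (\<lambda>t. l * ln (1 + t) - ln (1 + r * t))"
        using D by (intro DERIV_continuous_on) (auto intro: DERIV_subset)
      show "((\<lambda>t. l * ln (1 + t) - ln (1 + r * t)) has_real_derivative
         1 / (1 + u) * (l - r * (1 + u) / (1 + r * u))) (at u)" if "0 < u" "u < 1" for u
        using that by (intro DERIV_cong[OF D]) (auto simp: right_diff_distrib)
      show "r * (1 + s) / (1 + r * s) \<le> r * (1 + u) / (1 + r * u)"
        if "0 < s" "s \<le> u" "u < 1" for s u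
      proof -
        have "0 < 1 + r * s" "0 < 1 + r * u" using that r by (auto intro: add_pos_nonneg)
        \<comment> \<open>The difference of the two sides after clearing denominators.\<close>
        moreover have "0 \<le> r * (1 - r) * (u - s)" using that r by simp
        ultimately show ?thesis by (simp add: pos_divide_le_eq pos_le_divide_eq algebra_simps)
      qed
    qed (use l t in auto)
    moreover have "0 < 1 + r * t" using r t by (auto intro: add_pos_nonneg)
    ultimately have *: "1 + r * t \<le> (1 + t) powr l"
      using t by (intro le_powr_if_ln_le) auto
    have "(1 - eps i) * x + eps i * y = m * (1 + r * t)"
      unfolding a b r_def by (simp add: algebra_simps)
    also have "\<dots> \<le> m * (1 + t) powr l" using * m by simp
    also have "\<dots> = (m * (1 + t)) powr l * m powr (1 - l)"
    proof -
      have "m powr l * m powr (1 - l) = m" using m by (simp flip: powr_add)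
      then show ?thesis using m t by (simp add: powr_mult mult_ac)
    qed
    finally show ?thesis unfolding a[symmetric] unfolding m_def .
  qed
  show ?thesis
  proof (cases "b \<le> a")
    case True
    then show ?thesis using main[of b a] assms by (simp add: l_def max_def)
  next
    case False
    \<comment> \<open>When \<open>b\<close> is the larger value, moving the larger weight
      \<open>1 - eps i\<close> to it only increases the left side.\<close>
    have "0 \<le> (1 - 2 * eps i) * (b - a)" using False e by simp
    then have "(1 - eps i) * a + eps i * b \<le> (1 - eps i) * b + eps i * a"
      by (simp add: algebra_simps)
    also have "\<dots> \<le> b powr l * ((b + a) / 2) powr (1 - l)"
      using main[of a b] False assms by simp
    finally show ?thesis using False by (simp add: l_def max_def add_ac)
  qed
qed

section \<open>Noise operators on the cube\<close>

definition flip :: "nat \<Rightarrow> (nat \<Rightarrow> bool) \<Rightarrow> nat \<Rightarrow> bool" where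
  "flip i x = x(i := \<not> x i)"

lemma flip_flip [simp]: "flip i (flip i x) = x"
  by (auto simp: flip_def)

lemma flip_in_cube [simp]: "i < n \<Longrightarrow> flip i x \<in> cube n \<longleftrightarrow> x \<in> cube n"
  by (auto simp: flip_def cube_def)

lemma cube_0: "cube 0 = {\<lambda>_. False}"
  by (auto simp: cube_def)

lemma cube_Suc: "cube (Suc n) = cube n \<union> (\<lambda>x. x(n := True)) ` cube n"
proof (intro equalityI subsetI)
  fix x assume x: "x \<in> cube (Suc n)"
  show "x \<in> cube n \<union> (\<lambda>x. x(n := True)) ` cube n"
  proof (cases "x n")
    case True
    then have "x = (x(n := False))(n := True)" by (simp add: fun_eq_iff)
    moreover have "x(n := False) \<in> cube n"
      using x by (auto simp: cube_def Suc_le_eq)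
    ultimately show ?thesis by blast
  next
    case False
    then have "\<not> x i" if "n \<le> i" for i
      using x that by (cases "i = n") (auto simp: cube_def)
    then show ?thesis by (simp add: cube_def)
  qed
qed (auto simp: cube_def)

lemma finite_cube [simp]: "finite (cube n)"
  by (induction n) (simp_all add: cube_0 cube_Suc)

text \<open>Used to see that the noise weights sum to \<open>1\<close>.\<close>

lemma sum_cube_prod:
  "(\<Sum>y\<in>cube n. \<Prod>i<n. F i (y i)) = (\<Prod>i<n. F i True + F i False :: real)"
proof (induction n)
  case 0
  then show ?case by (simp add: cube_0)
next
  case (Suc n)
  have inj: "inj_on (\<lambda>x. x(n := True)) (cube n)"
  proof (rule inj_onI)
    fix x y :: "nat \<Rightarrow> bool"
    assume "x \<in> cube n" "y \<in> cube n" and eq: "x(n := True) = y(n := True)"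
    then have "x n = y n" by (simp add: cube_def)
    moreover have "x j = y j" if "j \<noteq> n" for j
      using fun_cong[OF eq, of j] that by simp
    ultimately show "x = y" by (intro ext) metis
  qed
  have "cube n \<inter> (\<lambda>x. x(n := True)) ` cube n = {}"
    by (auto simp: cube_def)
  then have "(\<Sum>y\<in>cube (Suc n). \<Prod>i<Suc n. F i (y i))
    = (\<Sum>y\<in>cube n. \<Prod>i<Suc n. F i (y i))
      + (\<Sum>y\<in>cube n. \<Prod>i<Suc n. F i ((y(n := True)) i))"
    unfolding cube_Suc by (subst sum.union_disjoint) (auto simp: sum.reindex[OF inj] o_def)
  also have "(\<Sum>y\<in>cube n. \<Prod>i<Suc n. F i (y i)) = (\<Sum>y\<in>cube n. (\<Prod>i<n. F i (y i)) * F n False)"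
    by (intro sum.cong) (auto simp: cube_def)
  also have "(\<Sum>y\<in>cube n. \<Prod>i<Suc n. F i ((y(n := True)) i))
      = (\<Sum>y\<in>cube n. (\<Prod>i<n. F i (y i)) * F n True)"
    by (intro sum.cong) (auto intro!: prod.cong)
  finally show ?case
    by (simp add: Suc flip: sum_distrib_right distrib_left)
qed

lemma noise_cong: "(\<And>i. i < n \<Longrightarrow> eta i = eps i) \<Longrightarrow> noise n eta f = noise n eps f"
  by (auto simp: noise_def fun_eq_iff intro!: sum.cong prod.cong)

text \<open>The kernel is a product over coordinates, so the noise in direction \<open>i\<close> can
  be applied last: with rate \<open>0\<close> at \<open>i\<close>, the kernel at \<open>x\<close>
  sees only \<open>y\<close> with \<open>y i = x i\<close>, and the kernel at
  \<open>flip i x\<close> only the others.\<close>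

lemma noise_coordinate:
  assumes "i < n"
  shows "noise n eta f x = (1 - eta i) * noise n (eta(i := 0)) f x
    + eta i * noise n (eta(i := 0)) f (flip i x)"
proof -
  define K where "K eta x y = (\<Prod>j<n. if y j = x j then 1 - eta j else eta j)"
    for eta :: "nat \<Rightarrow> real" and x y :: "nat \<Rightarrow> bool"
  have "K eta x y = (1 - eta i) * K (eta(i := 0)) x y + eta i * K (eta(i := 0)) (flip i x) y" for y
  proof -
    define R where "R = (\<Prod>j\<in>{..<n} - {i}. if y j = x j then 1 - eta j else eta j)"
    have "K eta x y = (if y i = x i then 1 - eta i else eta i) * R"
      using assms by (simp add: K_def R_def prod.remove[of "{..<n}" i])
    moreover have "K (eta(i := 0)) z y = (if y i = z i then R else 0)"
      if "\<And>j. j \<noteq> i \<Longrightarrow> z j = x j" for z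
    proof -
      have "(\<Prod>j\<in>{..<n} - {i}. if y j = z j then 1 - (eta(i := 0)) j else (eta(i := 0)) j) = R"
        unfolding R_def using that by (intro prod.cong) auto
      then show ?thesis
        using assms by (simp add: K_def prod.remove[of "{..<n}" i] del: fun_upd_apply) simp
    qed
    then have "K (eta(i := 0)) x y = (if y i = x i then R else 0)"
      "K (eta(i := 0)) (flip i x) y = (if y i = x i then 0 else R)"
      by (auto simp: flip_def)
    ultimately show ?thesis by auto
  qed
  moreover have "noise n eta f x = (\<Sum>y\<in>cube n. K eta x y * f y)" for eta x
    by (simp add: noise_def K_def)
  ultimately show ?thesis
    by (simp add: sum_distrib_left distrib_right sum.distrib mult.assoc)
qed

text \<open>Rate \<open>0\<close> freezes a coordinate and rate \<open>1 / 2\<close> resamples it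
  uniformly, so the kernel is constant on the points agreeing with \<open>x\<close> on
  \<open>T\<close> and zero elsewhere.\<close>

lemma condE_eq_noise:
  assumes "T \<subseteq> {..<n}"
  shows "condE n T f = noise n (\<lambda>i. if i \<in> T then 0 else 1 / 2) f"
proof
  fix x
  define S where "S = {y \<in> cube n. \<forall>i\<in>T. y i = x i}"
  define c :: real where "c = (1 / 2) ^ card ({..<n} - T)"
  have K: "(\<Prod>i<n. if y i = x i then 1 - (if i \<in> T then 0 else 1 / 2) else (if i \<in> T then 0 else 1 / 2))
      = (if \<forall>i\<in>T. y i = x i then c else 0)" for y
  proof (cases "\<forall>i\<in>T. y i = x i")
    case True
    have "(\<Prod>i<n. if y i = x i then 1 - (if i \<in> T then 0 else 1 / 2) else (if i \<in> T then 0 else 1 / 2))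
      = (\<Prod>i\<in>{..<n} - T. 1 / 2 :: real)"
      using True by (intro prod.mono_neutral_cong_right) auto
    then show ?thesis using True by (simp add: c_def)
  next
    case False
    then show ?thesis using assms by (auto intro!: prod_zero)
  qed
  have noise: "noise n (\<lambda>i. if i \<in> T then 0 else 1 / 2) g x = c * (\<Sum>y\<in>S. g y)" for g
  proof -
    have "noise n (\<lambda>i. if i \<in> T then 0 else 1 / 2) g x
        = (\<Sum>y\<in>cube n. if \<forall>i\<in>T. y i = x i then c * g y else 0)"
      unfolding noise_def K by (intro sum.cong) auto
    also have "\<dots> = c * (\<Sum>y\<in>S. g y)"
      by (simp add: S_def sum.inter_filter sum_distrib_left if_distrib cong: if_cong)
    finally show ?thesis .
  qed
  \<comment> \<open>The constant \<open>1\<close> is preserved, which identifies \<open>c\<close> as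
    \<open>1 / card S\<close> without counting \<open>S\<close>.\<close>
  have "noise n (\<lambda>i. if i \<in> T then 0 else 1 / 2) (\<lambda>_. 1) x = 1"
  proof -
    define F where "F i b = (if b = x i then 1 - (if i \<in> T then 0 else 1 / 2)
      else (if i \<in> T then 0 else 1 / 2 :: real))" for i b
    have "noise n (\<lambda>i. if i \<in> T then 0 else 1 / 2) (\<lambda>_. 1) x
        = (\<Sum>y\<in>cube n. \<Prod>i<n. F i (y i))"
      by (simp add: noise_def F_def)
    also have "\<dots> = 1" unfolding sum_cube_prod by (intro prod.neutral) (auto simp: F_def)
    finally show ?thesis .
  qed
  then have "c * real (card S) = 1" unfolding noise by simp
  then have "c = 1 / real (card S)" by (metis nonzero_eq_divide_eq mult_zero_right zero_neq_one)
  then show "condE n T f x = noise n (\<lambda>i. if i \<in> T then 0 else 1 / 2) f x"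
    unfolding noise by (simp add: condE_def S_def)
qed

lemma noise_nonneg:
  assumes "\<And>i. i < n \<Longrightarrow> 0 \<le> eta i \<and> eta i \<le> 1" "\<And>y. y \<in> cube n \<Longrightarrow> 0 \<le> f y"
  shows "0 \<le> noise n eta f x"
  unfolding noise_def using assms by (intro sum_nonneg mult_nonneg_nonneg prod_nonneg) auto

lemma noise_pos:
  assumes "\<And>i. i < n \<Longrightarrow> 0 \<le> eta i \<and> eta i < 1" "\<And>y. y \<in> cube n \<Longrightarrow> 0 \<le> f y"
    and "x \<in> cube n" "0 < f x"
  shows "0 < noise n eta f x"
  unfolding noise_def
proof (rule sum_pos2)
  show "0 < (\<Prod>i<n. if x i = x i then 1 - eta i else eta i) * f x"
    using assms by (auto intro!: mult_pos_pos prod_pos)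
  show "0 \<le> (\<Prod>i<n. if y i = x i then 1 - eta i else eta i) * f y" if "y \<in> cube n" for y
    using assms that by (intro mult_nonneg_nonneg prod_nonneg) (auto simp: less_imp_le)
qed (use assms in auto)

section \<open>Replacing the rates one at a time along a random subset\<close>

lemma rsexp_0: "rsexp 0 lam F = F {}"
  by (simp add: rsexp_def)

lemma rsexp_Suc:
  "rsexp (Suc m) lam F = rsexp m lam (\<lambda>T. lam m * F (insert m T) + (1 - lam m) * F T)"
proof -
  define w where "w k T = (\<Prod>i<k. if i \<in> T then lam i else 1 - lam i)" for k T
  have inj: "inj_on (insert m) (Pow {..<m})"
    by (intro inj_onI) (metis Diff_insert_absorb PowD lessThan_iff less_irrefl subsetD)
  have "rsexp (Suc m) lam F = (\<Sum>T\<in>Pow {..<m} \<union> insert m ` Pow {..<m}. w (Suc m) T * F T)"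
    by (simp add: rsexp_def w_def lessThan_Suc Pow_insert)
  also have "\<dots> = (\<Sum>T\<in>Pow {..<m}. w (Suc m) T * F T)
      + (\<Sum>T\<in>Pow {..<m}. w (Suc m) (insert m T) * F (insert m T))"
    by (subst sum.union_disjoint) (auto simp: sum.reindex[OF inj])
  also have "(\<Sum>T\<in>Pow {..<m}. w (Suc m) T * F T) = (\<Sum>T\<in>Pow {..<m}. w m T * ((1 - lam m) * F T))"
    by (intro sum.cong) (auto simp: w_def)
  also have "(\<Sum>T\<in>Pow {..<m}. w (Suc m) (insert m T) * F (insert m T))
      = (\<Sum>T\<in>Pow {..<m}. w m T * (lam m * F (insert m T)))"
  proof (intro sum.cong refl)
    fix T
    have "w m (insert m T) = w m T" unfolding w_def by (intro prod.cong) auto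
    then show "w (Suc m) (insert m T) * F (insert m T) = w m T * (lam m * F (insert m T))"
      by (simp add: w_def)
  qed
  finally show ?thesis
    by (simp add: rsexp_def w_def distrib_left sum.distrib)
qed

lemma rsexp_mono:
  assumes "\<And>i. i < m \<Longrightarrow> 0 \<le> lam i \<and> lam i \<le> 1" "\<And>T. T \<subseteq> {..<m} \<Longrightarrow> F T \<le> G T"
  shows "rsexp m lam F \<le> rsexp m lam G"
  unfolding rsexp_def using assms
  by (intro sum_mono mult_left_mono prod_nonneg) auto

text \<open>A hybrid argument: after \<open>m\<close> rounds the first \<open>m\<close> rates are
  \<open>0\<close> or \<open>1 / 2\<close> as \<open>T\<close> dictates, and the others are still
  \<open>eps\<close>. Each round expands every term by \<open>step\<close>, under nonnegative
  weights.\<close>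

lemma coordinatewise_bound:
  fixes L :: "(nat \<Rightarrow> real) \<Rightarrow> real"
  assumes step: "\<And>eta i. i < n \<Longrightarrow> (\<And>j. j < n \<Longrightarrow> eta j \<in> {eps j, 0, 1 / 2}) \<Longrightarrow> eta i = eps i \<Longrightarrow>
      L eta \<le> lam i * L (eta(i := 0)) + (1 - lam i) * L (eta(i := 1 / 2))"
    and lam: "\<And>i. i < n \<Longrightarrow> 0 \<le> lam i \<and> lam i \<le> 1"
  shows "m \<le> n \<Longrightarrow>
    L eps \<le> rsexp m lam (\<lambda>T. L (\<lambda>i. if i < m then if i \<in> T then 0 else 1 / 2 else eps i))"
proof (induction m)
  case 0
  then show ?case by (simp add: rsexp_0)
next
  case (Suc m)
  define E where "E k T = (\<lambda>i. if i < k then if i \<in> T then 0 else 1 / 2 else eps i)" for k T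
  have "L eps \<le> rsexp m lam (\<lambda>T. L (E m T))"
    using Suc by (simp add: E_def)
  also have "\<dots> \<le> rsexp m lam (\<lambda>T. lam m * L (E (Suc m) (insert m T)) + (1 - lam m) * L (E (Suc m) T))"
  proof (rule rsexp_mono)
    fix T assume T: "T \<subseteq> {..<m}"
    \<comment> \<open>Rate \<open>0\<close> at \<open>m\<close> corresponds to \<open>m\<close>
      joining \<open>T\<close>, and rate \<open>1 / 2\<close> to \<open>m\<close> staying
      out.\<close>
    have "(E m T)(m := 0) = E (Suc m) (insert m T)" "(E m T)(m := 1 / 2) = E (Suc m) T"
      using T by (auto simp: E_def fun_eq_iff)
    moreover have "L (E m T) \<le> lam m * L ((E m T)(m := 0)) + (1 - lam m) * L ((E m T)(m := 1 / 2))"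
      using Suc by (intro step) (auto simp: E_def)
    ultimately show "L (E m T) \<le> lam m * L (E (Suc m) (insert m T)) + (1 - lam m) * L (E (Suc m) T)"
      by simp
  qed (use lam Suc in auto)
  also have "\<dots> = rsexp (Suc m) lam (\<lambda>T. L (E (Suc m) T))"
    by (simp add: rsexp_Suc)
  finally show ?case by (simp add: E_def)
qed

text \<open>Kept general in \<open>\<Phi>\<close> so that it covers the logarithms of both norms and
  their negatives. Taking out the noise in direction \<open>i\<close> leaves \<open>h\<close>; rates
  \<open>eps i\<close>, \<open>0\<close> and \<open>1 / 2\<close> are then explicit combinations of
  \<open>h\<close> and its flip.\<close>

lemma noise_bound_by_condE:
  assumes eps: "\<And>i. i < n \<Longrightarrow> 0 \<le> eps i \<and> eps i \<le> 1 / 2"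
    and lam: "\<And>i. i < n \<Longrightarrow> 0 \<le> lam i \<and> lam i \<le> 1"
    and step: "\<And>eta i h. i < n \<Longrightarrow> (\<And>j. j < n \<Longrightarrow> 0 \<le> eta j \<and> eta j \<le> 1 / 2) \<Longrightarrow>
      h = noise n (eta(i := 0)) f \<Longrightarrow>
      \<Phi> (\<lambda>x. (1 - eps i) * h x + eps i * h (flip i x))
        \<le> lam i * \<Phi> h + (1 - lam i) * \<Phi> (\<lambda>x. (h x + h (flip i x)) / 2)"
  shows "(\<Phi> (noise n eps f) :: real) \<le> rsexp n lam (\<lambda>T. \<Phi> (condE n T f))"
proof -
  have "\<Phi> (noise n eps f) \<le> rsexp n lam (\<lambda>T. \<Phi> (noise n
      (\<lambda>i. if i < n then if i \<in> T then 0 else 1 / 2 else eps i) f))"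
  proof (rule coordinatewise_bound[where n = n])
    fix eta i assume i: "i < n" "\<And>j. j < n \<Longrightarrow> eta j \<in> {eps j, 0, 1 / 2}" "eta i = eps i"
    define h where "h = noise n (eta(i := 0)) f"
    have 1: "noise n eta f = (\<lambda>x. (1 - eps i) * h x + eps i * h (flip i x))"
      using noise_coordinate[OF i(1), of eta f] i(3) by (auto simp: h_def)
    have 2: "noise n (eta(i := 1 / 2)) f = (\<lambda>x. (h x + h (flip i x)) / 2)"
      using noise_coordinate[OF i(1), of "eta(i := 1 / 2)" f] by (auto simp: h_def field_simps)
    have "0 \<le> eta j \<and> eta j \<le> 1 / 2" if "j < n" for j
      using i(2)[OF that] eps[OF that] by auto
    from step[OF i(1) this h_def]
    show "\<Phi> (noise n eta f) \<le> lam i * \<Phi> (noise n (eta(i := 0)) f)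
        + (1 - lam i) * \<Phi> (noise n (eta(i := 1 / 2)) f)"
      unfolding 1 2 h_def[symmetric] by simp
  qed (use lam in auto)
  also have "\<dots> = rsexp n lam (\<lambda>T. \<Phi> (condE n T f))"
  proof -
    have "noise n (\<lambda>i. if i < n then if i \<in> T then 0 else 1 / 2 else eps i) f = condE n T f"
      if "T \<in> Pow {..<n}" for T
      using that by (subst condE_eq_noise) (auto intro: noise_cong)
    then show ?thesis by (simp add: rsexp_def)
  qed
  finally show ?thesis .
qed

text \<open>The inequality for \<open>\<Phi>\<close> and for \<open>- \<Phi>\<close>
  together.\<close>

lemma noise_eq_condE:
  assumes eps: "\<And>i. i < n \<Longrightarrow> 0 \<le> eps i \<and> eps i \<le> 1 / 2"
    and lam: "\<And>i. i < n \<Longrightarrow> 0 \<le> lam i \<and> lam i \<le> 1"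
    and step: "\<And>eta i h. i < n \<Longrightarrow> (\<And>j. j < n \<Longrightarrow> 0 \<le> eta j \<and> eta j \<le> 1 / 2) \<Longrightarrow>
      h = noise n (eta(i := 0)) f \<Longrightarrow>
      \<Phi> (\<lambda>x. (1 - eps i) * h x + eps i * h (flip i x))
        = lam i * \<Phi> h + (1 - lam i) * \<Phi> (\<lambda>x. (h x + h (flip i x)) / 2)"
  shows "(\<Phi> (noise n eps f) :: real) = rsexp n lam (\<lambda>T. \<Phi> (condE n T f))"
proof (rule antisym)
  show "\<Phi> (noise n eps f) \<le> rsexp n lam (\<lambda>T. \<Phi> (condE n T f))"
    using eps lam step by (intro noise_bound_by_condE) auto
  have "- \<Phi> (noise n eps f) \<le> rsexp n lam (\<lambda>T. - \<Phi> (condE n T f))"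
    using eps lam step by (intro noise_bound_by_condE[where \<Phi> = "\<lambda>g. - \<Phi> g"]) auto
  then show "rsexp n lam (\<lambda>T. \<Phi> (condE n T f)) \<le> \<Phi> (noise n eps f)"
    by (simp add: rsexp_def sum_negf)
qed

text \<open>If \<open>i \<in> K\<close>, rate \<open>0\<close> at \<open>i\<close> confines the
  support to \<open>x i = a i\<close>, and \<open>x\<close> and \<open>flip i x\<close> cannot both
  satisfy this. If \<open>i \<notin> K\<close>, the subcube is invariant under
  \<open>flip i\<close>, and flipping both arguments of the kernel leaves it unchanged.\<close>

lemma noise_charfun_subcube_flip:
  assumes "i < n"
  shows "(\<forall>x. noise n (eta(i := 0)) (charfun (subcube n K a)) x = 0
        \<or> noise n (eta(i := 0)) (charfun (subcube n K a)) (flip i x) = 0)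
    \<or> (\<forall>x. noise n (eta(i := 0)) (charfun (subcube n K a)) (flip i x)
        = noise n (eta(i := 0)) (charfun (subcube n K a)) x)"
proof (cases "i \<in> K")
  case True
  have "noise n (eta(i := 0)) (charfun (subcube n K a)) x = 0" if "x i \<noteq> a i" for x
    unfolding noise_def
  proof (intro sum.neutral ballI)
    fix y
    show "(\<Prod>j<n. if y j = x j then 1 - (eta(i := 0)) j else (eta(i := 0)) j)
        * charfun (subcube n K a) y = 0"
    proof (cases "y i = a i")
      case True
      then have "(\<Prod>j<n. if y j = x j then 1 - (eta(i := 0)) j else (eta(i := 0)) j) = 0"
        using that assms by (intro prod_zero) auto
      then show ?thesis by simp
    next
      case False
      then show ?thesis using \<open>i \<in> K\<close> by (auto simp: charfun_def subcube_def)
    qed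
  qed
  moreover have "x i \<noteq> a i \<or> flip i x i \<noteq> a i" for x by (auto simp: flip_def)
  ultimately show ?thesis by blast
next
  case False
  have f: "charfun (subcube n K a) (flip i y) = charfun (subcube n K a) y" for y
  proof -
    have "flip i y k = y k" if "k \<in> K" for k using that False by (auto simp: flip_def)
    then show ?thesis using assms by (simp add: charfun_def subcube_def)
  qed
  have "noise n (eta(i := 0)) (charfun (subcube n K a)) (flip i x)
      = noise n (eta(i := 0)) (charfun (subcube n K a)) x" for x
    unfolding noise_def
    by (rule sum.reindex_bij_witness[where i = "flip i" and j = "flip i"])
      (use assms in \<open>auto simp: f\<close>, auto simp: flip_def intro!: prod.cong)
  then show ?thesis by blast
qed

section \<open>Changing one coordinate\<close>

lemma sum_cube_flip: "i < n \<Longrightarrow> (\<Sum>x\<in>cube n. g (flip i x)) = (\<Sum>x\<in>cube n. g x)"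
  by (rule sum.reindex_bij_witness[where i = "flip i" and j = "flip i"]) auto

lemma cexp_flip: "i < n \<Longrightarrow> cexp n (\<lambda>x. g (flip i x)) = cexp n g"
  by (simp add: cexp_def sum_cube_flip)

lemma cexp_mono: "(\<And>x. x \<in> cube n \<Longrightarrow> g x \<le> h x) \<Longrightarrow> cexp n g \<le> cexp n h"
  unfolding cexp_def by (intro divide_right_mono sum_mono) auto

lemma cexp_add: "cexp n (\<lambda>x. g x + h x) = cexp n g + cexp n h"
  by (simp add: cexp_def sum.distrib add_divide_distrib)

lemma cexp_mult: "cexp n (\<lambda>x. c * g x) = c * cexp n g"
  by (simp add: cexp_def sum_distrib_left)

lemma cexp_pos:
  "(\<And>x. x \<in> cube n \<Longrightarrow> 0 \<le> g x) \<Longrightarrow> x \<in> cube n \<Longrightarrow> 0 < g x \<Longrightarrow> 0 < cexp n g"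
  unfolding cexp_def by (intro divide_pos_pos sum_pos2[of _ x]) auto

text \<open>Divide each function by its mean, apply weighted AM-GM pointwise and average.\<close>

lemma cexp_Holder:
  assumes "\<And>x. x \<in> cube n \<Longrightarrow> 0 \<le> g x" "\<And>x. x \<in> cube n \<Longrightarrow> 0 \<le> h x"
    and pos: "0 < cexp n g" "0 < cexp n h" and l: "0 \<le> l" "l \<le> 1"
  shows "cexp n (\<lambda>x. g x powr l * h x powr (1 - l)) \<le> cexp n g powr l * cexp n h powr (1 - l)"
proof -
  define c where "c = cexp n g powr l * cexp n h powr (1 - l)"
  have "g x powr l * h x powr (1 - l) \<le> c * (l / cexp n g) * g x + c * ((1 - l) / cexp n h) * h x"
    if "x \<in> cube n" for x
  \<comment> \<open>Here \<open>0 powr p = 0\<close> even for \<open>p = 0\<close>, so the product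
    vanishes; Young's inequality is applied to positive values only.\<close>
  proof (cases "g x = 0 \<or> h x = 0")
    case True
    have "0 \<le> c * (l / cexp n g) * g x + c * ((1 - l) / cexp n h) * h x"
      using assms that by (auto simp: c_def)
    then show ?thesis using True by auto
  next
    case False
    then have *: "0 < g x" "0 < h x" using assms(1,2)[OF that] by auto
    have "g x powr l * h x powr (1 - l)
        = c * ((g x / cexp n g) powr l * (h x / cexp n h) powr (1 - l))"
      using * pos by (simp add: c_def powr_divide)
    also have "\<dots> \<le> c * (l * (g x / cexp n g) + (1 - l) * (h x / cexp n h))"
      using * pos l by (intro mult_left_mono Youngs_inequality_0) (auto simp: c_def)
    finally show ?thesis by (simp add: algebra_simps)
  qed
  then have "cexp n (\<lambda>x. g x powr l * h x powr (1 - l))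
      \<le> cexp n (\<lambda>x. c * (l / cexp n g) * g x + c * ((1 - l) / cexp n h) * h x)"
    by (rule cexp_mono)
  also have "\<dots> = c * (l / cexp n g) * cexp n g + c * ((1 - l) / cexp n h) * cexp n h"
    by (simp only: cexp_add cexp_mult)
  also have "\<dots> = c" using pos by (simp add: field_simps)
  finally show ?thesis by (simp add: c_def)
qed

section \<open>Replacing one rate in the \<open>q\<close>-norm\<close>

lemma ln_qnorm:
  assumes "x \<in> cube n" "g x \<noteq> 0" "0 < q"
  shows "ln (qnorm n q g) = ln (cexp n (\<lambda>x. \<bar>g x\<bar> ^ q)) / q"
proof -
  have "0 < cexp n (\<lambda>x. \<bar>g x\<bar> ^ q)"
    using assms by (intro cexp_pos[where x = x]) auto
  then show ?thesis by (simp add: qnorm_def ln_powr)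
qed

lemma convex_flip_pos:
  assumes "0 \<le> e" "e \<le> 1 / 2" and i: "i < n" and h: "\<And>x. x \<in> cube n \<Longrightarrow> 0 \<le> h x"
    and "z \<in> cube n" "h z \<noteq> (0::real)"
  shows "(1 - e) * h z + e * h (flip i z) \<noteq> 0"
proof -
  have "0 < h z" "0 \<le> h (flip i z)"
    using assms h[of z] h[of "flip i z"] by (auto simp: less_le)
  then have "0 < (1 - e) * h z" "0 \<le> e * h (flip i z)"
    using assms(1,2) by auto
  then show ?thesis by linarith
qed

text \<open>Apply the two-point bound on each pair \<open>x\<close>, \<open>flip i x\<close>, then
  Hoelder with exponents \<open>l\<close> and \<open>1 - l\<close>, and take logarithms. Averaging
  over pairs does not change the mean of \<open>h x ^ q\<close>.\<close>

lemma qnorm_step: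
  assumes e: "0 \<le> eps i" "eps i \<le> 1 / 2" and q: "2 \<le> q" and i: "i < n"
    and h: "\<And>x. x \<in> cube n \<Longrightarrow> 0 \<le> h x" and z: "z \<in> cube n" "h z \<noteq> 0"
  shows "ln (qnorm n q (\<lambda>x. (1 - eps i) * h x + eps i * h (flip i x)))
    \<le> lam_q q eps i * ln (qnorm n q h)
      + (1 - lam_q q eps i) * ln (qnorm n q (\<lambda>x. (h x + h (flip i x)) / 2))"
proof -
  define l where "l = lam_q q eps i"
  define N where "N = (\<lambda>x. (1 - eps i) * h x + eps i * h (flip i x))"
  define M where "M = (\<lambda>x. (h x + h (flip i x)) / 2)"
  define S where "S = (\<lambda>x. (h x ^ q + h (flip i x) ^ q) / 2)"
  have h': "0 \<le> h (flip i x)" if "x \<in> cube n" for x using h i that by simp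
  have N0: "0 \<le> N x" and M0: "0 \<le> M x" if "x \<in> cube n" for x
    using h[OF that] h'[OF that] e by (auto simp: N_def M_def)
  have Nz: "N z \<noteq> 0" unfolding N_def by (rule convex_flip_pos[where n = n]) (use assms in auto)
  have Mz: "M z \<noteq> 0" using convex_flip_pos[of "1 / 2" i n h z] assms by (auto simp: M_def)
  have W: "cexp n (\<lambda>x. \<bar>g x\<bar> ^ q) = cexp n (\<lambda>x. g x ^ q)" if "\<And>x. x \<in> cube n \<Longrightarrow> 0 \<le> g x" for g
    using that by (auto simp: cexp_def intro!: sum.cong)
  have P: "0 < cexp n (\<lambda>x. g x ^ q)" if "\<And>x. x \<in> cube n \<Longrightarrow> 0 \<le> g x" "g z \<noteq> 0" for g
    using that z less_le by (intro cexp_pos[where x = z]) fastforce+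
  have S: "cexp n S = cexp n (\<lambda>x. h x ^ q)"
  proof -
    have "cexp n S = cexp n (\<lambda>x. 1 / 2 * h x ^ q + 1 / 2 * h (flip i x) ^ q)"
      by (simp add: S_def add_divide_distrib)
    also have "\<dots> = cexp n (\<lambda>x. h x ^ q)"
      unfolding cexp_add cexp_mult using cexp_flip[OF i, of "\<lambda>x. h x ^ q"] by simp
    finally show ?thesis .
  qed
  \<comment> \<open>Symmetrising in direction \<open>i\<close> produces the left side of
    \<open>two_point\<close> at every point.\<close>
  have "cexp n (\<lambda>x. N x ^ q) = cexp n (\<lambda>x. 1 / 2 * N x ^ q + 1 / 2 * N (flip i x) ^ q)"
    unfolding cexp_add cexp_mult using cexp_flip[OF i, of "\<lambda>x. N x ^ q"] by simp
  also have "\<dots> \<le> cexp n (\<lambda>x. S x powr l * (M x ^ q) powr (1 - l))"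
  proof (rule cexp_mono)
    fix x assume x: "x \<in> cube n"
    from two_point[of eps i, OF e q h[OF x] h'[OF x]]
    show "1 / 2 * N x ^ q + 1 / 2 * N (flip i x) ^ q \<le> S x powr l * (M x ^ q) powr (1 - l)"
      by (simp add: N_def S_def M_def l_def add_divide_distrib)
  qed
  also have "\<dots> \<le> cexp n S powr l * cexp n (\<lambda>x. M x ^ q) powr (1 - l)"
  proof (rule cexp_Holder)
    show "0 \<le> S x" if "x \<in> cube n" for x using h h' that by (simp add: S_def)
  qed (use M0 P[of M, OF M0 Mz] P[of h, OF h z(2)] lam_q_bounds[of eps i, OF e q]
      in \<open>auto simp: S l_def\<close>)
  finally have "ln (cexp n (\<lambda>x. N x ^ q)) \<le> ln (cexp n S powr l * cexp n (\<lambda>x. M x ^ q) powr (1 - l))"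
    using P[of N, OF N0 Nz] P[of M, OF M0 Mz] P[of h, OF h z(2)] by (subst ln_le_cancel_iff) (auto simp: S)
  also have "\<dots> = l * ln (cexp n (\<lambda>x. h x ^ q)) + (1 - l) * ln (cexp n (\<lambda>x. M x ^ q))"
    using P[of M, OF M0 Mz] P[of h, OF h z(2)] by (simp add: ln_mult ln_powr S)
  finally have "ln (cexp n (\<lambda>x. N x ^ q)) / q
      \<le> (l * ln (cexp n (\<lambda>x. h x ^ q)) + (1 - l) * ln (cexp n (\<lambda>x. M x ^ q))) / q"
    by (rule divide_right_mono) simp
  then have "ln (qnorm n q N) \<le> l * ln (qnorm n q h) + (1 - l) * ln (qnorm n q M)"
    using ln_qnorm[of z n N q] ln_qnorm[of z n M q] ln_qnorm[of z n h q] z Nz Mz q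
    by (simp add: W[of N, OF N0] W[of M, OF M0] W[of h, OF h] add_divide_distrib)
  then show ?thesis by (simp add: N_def M_def l_def)
qed

text \<open>At every point at most one of the two summands is nonzero, so the \<open>q\<close>-th
  power of the sum splits; \<open>q > 0\<close> ensures that the vanishing one contributes
  \<open>0\<close>.\<close>

lemma cexp_power_of_disjoint:
  assumes e: "0 \<le> e" "e \<le> 1 / 2" and q: "0 < q" and i: "i < n"
    and h: "\<And>x. x \<in> cube n \<Longrightarrow> (0::real) \<le> h x"
    and disj: "\<And>x. h x = 0 \<or> h (flip i x) = 0"
  shows "cexp n (\<lambda>x. \<bar>(1 - e) * h x + e * h (flip i x)\<bar> ^ q)
    = (e ^ q + (1 - e) ^ q) * cexp n (\<lambda>x. \<bar>h x\<bar> ^ q)"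
proof -
  have "\<bar>(1 - e) * h x + e * h (flip i x)\<bar> ^ q
      = (1 - e) ^ q * \<bar>h x\<bar> ^ q + e ^ q * \<bar>h (flip i x)\<bar> ^ q" for x
    using disj[of x] e q by (auto simp: abs_mult power_mult_distrib)
  then have "cexp n (\<lambda>x. \<bar>(1 - e) * h x + e * h (flip i x)\<bar> ^ q)
    = (1 - e) ^ q * cexp n (\<lambda>x. \<bar>h x\<bar> ^ q) + e ^ q * cexp n (\<lambda>x. \<bar>h (flip i x)\<bar> ^ q)"
    by (simp add: cexp_add cexp_mult)
  also have "cexp n (\<lambda>x. \<bar>h (flip i x)\<bar> ^ q) = cexp n (\<lambda>x. \<bar>h x\<bar> ^ q)"
    using cexp_flip[OF i, of "\<lambda>x. \<bar>h x\<bar> ^ q"] .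
  finally show ?thesis by (simp add: algebra_simps)
qed

lemma qnorm_step_eq:
  assumes e: "0 \<le> eps i" "eps i \<le> 1 / 2" and q: "2 \<le> q" and i: "i < n"
    and h: "\<And>x. x \<in> cube n \<Longrightarrow> 0 \<le> h x" and z: "z \<in> cube n" "h z \<noteq> 0"
    and cases: "(\<forall>x. h x = 0 \<or> h (flip i x) = 0) \<or> (\<forall>x. h (flip i x) = h x)"
  shows "ln (qnorm n q (\<lambda>x. (1 - eps i) * h x + eps i * h (flip i x)))
    = lam_q q eps i * ln (qnorm n q h)
      + (1 - lam_q q eps i) * ln (qnorm n q (\<lambda>x. (h x + h (flip i x)) / 2))"
  using cases
proof
  assume disj: "\<forall>x. h x = 0 \<or> h (flip i x) = 0"
  define N where "N e = (\<lambda>x. (1 - e) * h x + e * h (flip i x))" for e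
  define W where "W = cexp n (\<lambda>x. \<bar>h x\<bar> ^ q)"
  define p where "p e = e ^ q + (1 - e) ^ q" for e :: real
  have W: "0 < W" unfolding W_def using z by (intro cexp_pos[where x = z]) auto
  have ppos: "0 < p e" if "0 \<le> e" "e \<le> 1 / 2" for e
    using that by (auto simp: p_def intro: add_nonneg_pos)
  have N: "ln (qnorm n q (N e)) = (ln (p e) + ln W) / q" if e: "0 \<le> e" "e \<le> 1 / 2" for e
  proof -
    have "N e z \<noteq> 0" unfolding N_def by (rule convex_flip_pos[where n = n]) (use e i h z in auto)
    then have "ln (qnorm n q (N e)) = ln (cexp n (\<lambda>x. \<bar>N e x\<bar> ^ q)) / q"
      using z q by (intro ln_qnorm) auto
    also have "cexp n (\<lambda>x. \<bar>N e x\<bar> ^ q) = p e * W"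
      unfolding N_def p_def W_def using e q i h disj by (intro cexp_power_of_disjoint) auto
    finally show ?thesis using W ppos[OF e] by (simp add: ln_mult)
  qed
  have "p (1 / 2) = 2 * (1 / 2) ^ q" by (simp add: p_def)
  then have p_half: "ln (p (1 / 2)) = - ((real q - 1) * ln 2)"
    by (simp add: ln_mult ln_realpow ln_div algebra_simps)
  have M: "(\<lambda>x. (h x + h (flip i x)) / 2) = N (1 / 2)"
    by (simp add: N_def add_divide_distrib fun_eq_iff)
  \<comment> \<open>With \<open>p (1 / 2) = 2 powr (1 - q)\<close>, this says that
    \<open>p (eps i)\<close> is \<open>p (1 / 2)\<close> to the power
    \<open>1 - lam_q q eps i\<close>, which is exactly the required equality.\<close>
  have l: "(1 - lam_q q eps i) * ((real q - 1) * ln 2) = - ln (p (eps i))"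
    using q by (simp add: lam_q_def log_def p_def)
  have "lam_q q eps i * ln W + (1 - lam_q q eps i) * (ln (p (1 / 2)) + ln W)
      = ln W - (1 - lam_q q eps i) * ((real q - 1) * ln 2)"
    unfolding p_half by (simp add: algebra_simps)
  also have "\<dots> = ln (p (eps i)) + ln W" unfolding l by simp
  finally have "(ln (p (eps i)) + ln W) / q
      = lam_q q eps i * (ln W / q) + (1 - lam_q q eps i) * ((ln (p (1 / 2)) + ln W) / q)"
    by (metis add_divide_distrib times_divide_eq_right)
  moreover have "ln (qnorm n q h) = ln W / q"
    unfolding W_def using z q by (intro ln_qnorm) auto
  ultimately have "ln (qnorm n q (N (eps i)))
      = lam_q q eps i * ln (qnorm n q h) + (1 - lam_q q eps i) * ln (qnorm n q (N (1 / 2)))"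
    using N[OF e] N[of "1 / 2"] by simp
  then show ?thesis unfolding M by (simp add: N_def)
next
  assume "\<forall>x. h (flip i x) = h x"
  then have "(\<lambda>x. (1 - eps i) * h x + eps i * h (flip i x)) = h"
    "(\<lambda>x. (h x + h (flip i x)) / 2) = h"
    by (auto simp: algebra_simps)
  then show ?thesis by (simp add: algebra_simps)
qed

section \<open>Replacing one rate in the maximum norm\<close>

lemma infnorm_ge: "x \<in> cube n \<Longrightarrow> \<bar>g x\<bar> \<le> infnorm n g"
  by (simp add: infnorm_def)

lemma infnorm_pos: "x \<in> cube n \<Longrightarrow> g x \<noteq> 0 \<Longrightarrow> 0 < infnorm n g"
  using infnorm_ge[of x n g] by linarith

lemma infnorm_attained:
  obtains x where "x \<in> cube n" "infnorm n g = \<bar>g x\<bar>"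
proof -
  have "(\<lambda>_. False) \<in> cube n" by (simp add: cube_def)
  then have "infnorm n g \<in> (\<lambda>x. \<bar>g x\<bar>) ` cube n"
    unfolding infnorm_def by (intro Max_in) auto
  then show ?thesis using that by auto
qed

lemma infnorm_step:
  assumes e: "0 \<le> eps i" "eps i \<le> 1 / 2" and i: "i < n"
    and h: "\<And>x. x \<in> cube n \<Longrightarrow> 0 \<le> h x" and z: "z \<in> cube n" "h z \<noteq> 0"
  shows "ln (infnorm n (\<lambda>x. (1 - eps i) * h x + eps i * h (flip i x)))
    \<le> lam_inf eps i * ln (infnorm n h)
      + (1 - lam_inf eps i) * ln (infnorm n (\<lambda>x. (h x + h (flip i x)) / 2))"
proof -
  define l where "l = lam_inf eps i"
  have l: "0 \<le> l" "l \<le> 1" using lam_inf_bounds[of eps i, OF e] by (auto simp: l_def)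
  define N where "N = (\<lambda>x. (1 - eps i) * h x + eps i * h (flip i x))"
  define M where "M = (\<lambda>x. (h x + h (flip i x)) / 2)"
  have h': "0 \<le> h (flip i x)" if "x \<in> cube n" for x using h i that by simp
  have Nz: "N z \<noteq> 0" unfolding N_def by (rule convex_flip_pos[where n = n]) (use assms in auto)
  have Mz: "M z \<noteq> 0" using convex_flip_pos[of "1 / 2" i n h z] assms by (auto simp: M_def)
  have pos: "0 < infnorm n N" "0 < infnorm n M" "0 < infnorm n h"
    using z Nz Mz by (auto intro: infnorm_pos)
  obtain x where x: "x \<in> cube n" "infnorm n N = \<bar>N x\<bar>" by (rule infnorm_attained)
  have "infnorm n N = (1 - eps i) * h x + eps i * h (flip i x)"
    using x h h' e by (simp add: N_def)
  \<comment> \<open>At a point where \<open>N\<close> is maximal the pointwise bound suffices; each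
    factor is then at most the corresponding norm.\<close>
  also have "\<dots> \<le> max (h x) (h (flip i x)) powr l * M x powr (1 - l)"
    unfolding l_def M_def using e h h' x by (intro two_point_inf) auto
  also have "\<dots> \<le> infnorm n h powr l * infnorm n M powr (1 - l)"
    using infnorm_ge[OF x(1), of h] infnorm_ge[of "flip i x" n h] infnorm_ge[OF x(1), of M] x i l
      h[OF x(1)] h'[OF x(1)]
    by (intro mult_mono powr_mono2) (auto simp: M_def)
  finally have "ln (infnorm n N) \<le> ln (infnorm n h powr l * infnorm n M powr (1 - l))"
    using pos by (subst ln_le_cancel_iff) auto
  also have "\<dots> = l * ln (infnorm n h) + (1 - l) * ln (infnorm n M)"
    using pos by (simp add: ln_mult ln_powr)
  finally show ?thesis by (simp add: N_def M_def l_def)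
qed

text \<open>Each value is a value of \<open>h\<close> with weight \<open>1 - e\<close> or
  \<open>e\<close>, and \<open>e \<le> 1 - e\<close>. The larger weight is reached at a maximum of
  \<open>\<bar>h\<bar>\<close>.\<close>

lemma infnorm_of_disjoint:
  assumes e: "0 \<le> e" "e \<le> 1 / 2" and i: "i < n"
    and disj: "\<And>x. h x = 0 \<or> h (flip i x) = 0"
  shows "infnorm n (\<lambda>x. (1 - e) * h x + e * h (flip i x)) = (1 - e) * infnorm n h"
proof -
  define N where "N = (\<lambda>x. (1 - e) * h x + e * h (flip i x))"
  have le: "\<bar>N x\<bar> \<le> (1 - e) * infnorm n h" if "x \<in> cube n" for x
  proof (cases "h x = 0")
    case True
    then have "\<bar>N x\<bar> = e * \<bar>h (flip i x)\<bar>" using e by (simp add: N_def abs_mult)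
    also have "\<dots> \<le> (1 - e) * infnorm n h"
      using infnorm_ge[of "flip i x" n h] that i e by (intro mult_mono) auto
    finally show ?thesis .
  next
    case False
    then have "\<bar>N x\<bar> = (1 - e) * \<bar>h x\<bar>" using e disj[of x] by (simp add: N_def abs_mult)
    then show ?thesis using infnorm_ge[OF that, of h] e by (simp add: mult_left_mono)
  qed
  obtain x where x: "x \<in> cube n" "infnorm n h = \<bar>h x\<bar>" by (rule infnorm_attained)
  have "(1 - e) * \<bar>h x\<bar> \<le> \<bar>N x\<bar>"
    using disj[of x] e by (auto simp: N_def abs_mult)
  with infnorm_ge[OF x(1), of N] x have "(1 - e) * infnorm n h \<le> infnorm n N" by simp
  moreover obtain y where "y \<in> cube n" "infnorm n N = \<bar>N y\<bar>" by (rule infnorm_attained)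
  ultimately have "infnorm n N = (1 - e) * infnorm n h" using le[of y] by linarith
  then show ?thesis by (simp add: N_def)
qed

lemma infnorm_step_eq:
  assumes e: "0 \<le> eps i" "eps i \<le> 1 / 2" and i: "i < n"
    and z: "z \<in> cube n" "h z \<noteq> 0"
    and cases: "(\<forall>x. h x = 0 \<or> h (flip i x) = 0) \<or> (\<forall>x. h (flip i x) = h x)"
  shows "ln (infnorm n (\<lambda>x. (1 - eps i) * h x + eps i * h (flip i x)))
    = lam_inf eps i * ln (infnorm n h)
      + (1 - lam_inf eps i) * ln (infnorm n (\<lambda>x. (h x + h (flip i x)) / 2))"
  using cases
proof
  assume disj: "\<forall>x. h x = 0 \<or> h (flip i x) = 0"
  have pos: "0 < infnorm n h" using z by (rule infnorm_pos)
  have M: "(\<lambda>x. (h x + h (flip i x)) / 2) = (\<lambda>x. (1 - 1 / 2) * h x + 1 / 2 * h (flip i x))"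
    by (simp add: add_divide_distrib fun_eq_iff)
  have 1: "infnorm n (\<lambda>x. (h x + h (flip i x)) / 2) = infnorm n h / 2"
    unfolding M using infnorm_of_disjoint[of "1 / 2" i n h] i disj by simp
  have 2: "infnorm n (\<lambda>x. (1 - eps i) * h x + eps i * h (flip i x)) = (1 - eps i) * infnorm n h"
    using infnorm_of_disjoint[of "eps i" i n h] e i disj by simp
  \<comment> \<open>Averaging halves the norm and noise multiplies it by \<open>1 - eps i\<close>,
    so the equality reduces to \<open>2 powr (lam_inf eps i - 1) = 1 - eps i\<close>.\<close>
  have "(1 - lam_inf eps i) * ln 2 = - ln (1 - eps i)"
    by (simp add: lam_inf_def log_def)
  then show ?thesis
    unfolding 1 2 using pos e by (simp add: ln_mult ln_div) (simp add: algebra_simps)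
next
  assume "\<forall>x. h (flip i x) = h x"
  then have "(\<lambda>x. (1 - eps i) * h x + eps i * h (flip i x)) = h"
    "(\<lambda>x. (h x + h (flip i x)) / 2) = h"
    by (auto simp: algebra_simps)
  then show ?thesis by (simp add: algebra_simps)
qed

theorem theorem2p1:
  fixes n :: nat and eps :: "nat \<Rightarrow> real"
  assumes "n \<ge> 1"
    and "\<And>i. i < n \<Longrightarrow> 0 \<le> eps i \<and> eps i \<le> 1 / 2"
  shows "(\<forall>f :: (nat \<Rightarrow> bool) \<Rightarrow> real.
            (\<forall>x\<in>cube n. 0 \<le> f x) \<and> (\<exists>x\<in>cube n. f x \<noteq> 0) \<longrightarrow>
              (\<forall>q::nat. q \<ge> 2 \<longrightarrow>
                 ln (qnorm n q (noise n eps f))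
                   \<le> rsexp n (lam_q q eps) (\<lambda>T. ln (qnorm n q (condE n T f))))
            \<and> ln (infnorm n (noise n eps f))
                \<le> rsexp n (lam_inf eps) (\<lambda>T. ln (infnorm n (condE n T f))))
       \<and> (\<forall>K a. K \<subseteq> {..<n} \<longrightarrow>
            (let f = charfun (subcube n K a) in
              (\<forall>q::nat. q \<ge> 2 \<longrightarrow>
                 ln (qnorm n q (noise n eps f))
                   = rsexp n (lam_q q eps) (\<lambda>T. ln (qnorm n q (condE n T f))))
            \<and> ln (infnorm n (noise n eps f))
                = rsexp n (lam_inf eps) (\<lambda>T. ln (infnorm n (condE n T f)))))"
proof -
  note eps = assms(2)
  have lam_q: "0 \<le> lam_q q eps i \<and> lam_q q eps i \<le> 1" if "i < n" "2 \<le> q" for i q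
    using lam_q_bounds[of eps i q] eps[OF that(1)] that by simp
  have lam_inf: "0 \<le> lam_inf eps i \<and> lam_inf eps i \<le> 1" if "i < n" for i
    using lam_inf_bounds[of eps i] eps[OF that] by simp
  \<comment> \<open>All rates are below \<open>1\<close>, so a point where \<open>f\<close> is
    positive remains one after noise. The same \<open>z\<close> therefore witnesses nonvanishing in
    every single replacement.\<close>
  have noise: "(\<forall>x. 0 \<le> noise n (eta(i := 0)) f x) \<and> noise n (eta(i := 0)) f z \<noteq> 0"
    if "\<forall>x\<in>cube n. 0 \<le> f x" "z \<in> cube n" "f z \<noteq> 0"
      and eta: "\<forall>j<n. 0 \<le> eta j \<and> eta j \<le> 1 / 2" for f z eta i
  proof -
    have eta': "0 \<le> (eta(i := 0)) j \<and> (eta(i := 0)) j \<le> 1"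
      "0 \<le> (eta(i := 0)) j \<and> (eta(i := 0)) j < 1" if "j < n" for j
      using eta that by fastforce+
    have "0 < f z" using that(1-3) by (auto simp: less_le)
    then have "0 < noise n (eta(i := 0)) f z"
      using eta'(2) that(1,2) by (intro noise_pos) auto
    moreover have "0 \<le> noise n (eta(i := 0)) f x" for x
      using eta'(1) that(1) by (intro noise_nonneg) auto
    ultimately show ?thesis by simp
  qed
  have "ln (qnorm n q (noise n eps f)) \<le> rsexp n (lam_q q eps) (\<lambda>T. ln (qnorm n q (condE n T f)))"
    if f: "\<forall>x\<in>cube n. 0 \<le> f x" "z \<in> cube n" "f z \<noteq> 0" and q: "2 \<le> q" for f z q
    using noise[of f z, OF f] eps lam_q q f(2)
    by (intro noise_bound_by_condE[where \<Phi> = "\<lambda>g. ln (qnorm n q g)"] qnorm_step[where z = z]) auto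
  moreover have "ln (infnorm n (noise n eps f))
      \<le> rsexp n (lam_inf eps) (\<lambda>T. ln (infnorm n (condE n T f)))"
    if f: "\<forall>x\<in>cube n. 0 \<le> f x" "z \<in> cube n" "f z \<noteq> 0" for f z
    using noise[of f z, OF f] eps lam_inf f(2)
    by (intro noise_bound_by_condE[where \<Phi> = "\<lambda>g. ln (infnorm n g)"] infnorm_step[where z = z]) auto
  moreover have "\<forall>q\<ge>2. ln (qnorm n q (noise n eps f))
      = rsexp n (lam_q q eps) (\<lambda>T. ln (qnorm n q (condE n T f)))"
    "ln (infnorm n (noise n eps f)) = rsexp n (lam_inf eps) (\<lambda>T. ln (infnorm n (condE n T f)))"
    if K: "K \<subseteq> {..<n}" and f_def: "f = charfun (subcube n K a)" for K a f
  proof -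
    \<comment> \<open>The point equal to \<open>a\<close> on \<open>K\<close> and
      \<open>False\<close> elsewhere lies in the subcube; it is in \<open>cube n\<close> because
      \<open>K \<subseteq> {..<n}\<close>.\<close>
    have f: "\<forall>x\<in>cube n. 0 \<le> f x" "(\<lambda>i. i \<in> K \<and> a i) \<in> cube n" "f (\<lambda>i. i \<in> K \<and> a i) \<noteq> 0"
      using K by (auto simp: f_def charfun_def subcube_def cube_def)
    note noise_f = noise[of f, OF f]
    have disj: "(\<forall>x. h x = 0 \<or> h (flip i x) = 0) \<or> (\<forall>x. h (flip i x) = h x)"
      if "h = noise n (eta(i := 0)) f" "i < n" for h eta i
      using noise_charfun_subcube_flip[OF that(2), of eta K a] unfolding that(1) f_def .
    show "\<forall>q\<ge>2. ln (qnorm n q (noise n eps f))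
      = rsexp n (lam_q q eps) (\<lambda>T. ln (qnorm n q (condE n T f)))"
    proof (intro allI impI noise_eq_condE[where \<Phi> = "\<lambda>g. ln (qnorm n q g)" for q])
      fix eta i h and q :: nat
      assume q: "2 \<le> q"
      assume "i < n" "\<And>j. j < n \<Longrightarrow> 0 \<le> eta j \<and> eta j \<le> 1 / 2" "h = noise n (eta(i := 0)) f"
      then have i: "i < n" "\<forall>j<n. 0 \<le> eta j \<and> eta j \<le> 1 / 2" "h = noise n (eta(i := 0)) f" by auto
      show "ln (qnorm n q (\<lambda>x. (1 - eps i) * h x + eps i * h (flip i x)))
        = lam_q q eps i * ln (qnorm n q h)
          + (1 - lam_q q eps i) * ln (qnorm n q (\<lambda>x. (h x + h (flip i x)) / 2))"
        using noise_f[of eta i, OF i(2)] eps[OF i(1)] q i(1) f(2) disj[OF i(3,1)]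
        by (intro qnorm_step_eq) (auto simp: i(3))
    qed (use eps lam_q in auto)
    show "ln (infnorm n (noise n eps f)) = rsexp n (lam_inf eps) (\<lambda>T. ln (infnorm n (condE n T f)))"
    proof (rule noise_eq_condE[where \<Phi> = "\<lambda>g. ln (infnorm n g)"])
      fix eta i h
      assume "i < n" "\<And>j. j < n \<Longrightarrow> 0 \<le> eta j \<and> eta j \<le> 1 / 2" "h = noise n (eta(i := 0)) f"
      then have i: "i < n" "\<forall>j<n. 0 \<le> eta j \<and> eta j \<le> 1 / 2" "h = noise n (eta(i := 0)) f" by auto
      show "ln (infnorm n (\<lambda>x. (1 - eps i) * h x + eps i * h (flip i x)))
        = lam_inf eps i * ln (infnorm n h)
          + (1 - lam_inf eps i) * ln (infnorm n (\<lambda>x. (h x + h (flip i x)) / 2))"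
        using noise_f[of eta i, OF i(2)] eps[OF i(1)] i(1) f(2) disj[OF i(3,1)]
        by (intro infnorm_step_eq) (auto simp: i(3))
    qed (use eps lam_inf in auto)
  qed
  ultimately show ?thesis by (auto simp: Let_def)
qed

end
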